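(* Let $\mathcal M$ be a set of stochastic $m\times m$ matrices such that $\mathcal M$ is compact and there exists $r>0$ such that for any $G=[G_{ij}]_{i,j=1}^m\in\mathcal M$, $G_{ij}>0$ implies $G_{ij}\ge r$, and all diagonal elements satisfy $G_{ii}>r$, $i=1,\dots,m$. Let $\mathcal G=\{G(t)\}_{t\in\mathbb Z^+}\subset\mathcal M$ be a stochastic matrix sequence, with corresponding graph sequence $\{\Gamma(t)\}_{t\in\mathbb Z^+}$. Then the following statements are equivalent: 1. $\operatorname{diam}(\mathcal G)<1$; 2. there exists $T>0$ such that for any $t_0$, the graph $\bigcup_{k=t_0}^{t_0+T}\Gamma(k)$ has a spanning tree; 3. the stochastic matrix sequence $\mathcal G$ is uniformly ergodic.
   Context: $\mathbb Z^+=\{0,1,2,\dots\}$; $T$ is an integer and $t_0\in\mathbb Z^+$. A stochastic matrix has nonnegative entries and all row sums $1$. Hajnal diameter: for a real matrix $L$ with rows $g_1,\dots,g_m$ and a vector norm, $\operatorname{diam}(L)=\max_{i,j}\|g_i-g_j\|$. With the left product $\prod_{k=a}^bA_k=A_b\cdots A_a$, $$\operatorname{diam}(\mathcal G)=\limsup_{t\to\infty}\sup_{t_0\ge0}\Big(\operatorname{diam}\prod_{k=t_0}^{t_0+t-1}G(k)\Big)^{1/t}$$ (independent of the norm). Graphs: the stochastic matrix $G$ corresponds to the simple directed graph with vertex set $V=\{1,\dots,m\}$ and a directed edge from vertex $j$ to vertex $i\neq j$ if and only if $G_{ij}>0$; $\Gamma(t)=[V,E(t)]$ is the graph of $G(t)$.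 The union $\bigcup_{k=t_1}^{t_2}\Gamma(k)$ is $[V,\bigcup_{k=t_1}^{t_2}E(k)]$. A graph has a spanning tree if there is a vertex (the root) such that for each other vertex $j$ there is at least one directed path from the root to $j$. $\mathcal G$ is uniformly ergodic if for any $\epsilon>0$ there exists $T>0$ such that $\operatorname{diam}\big(\prod_{s=t_0}^{t_0+t-1}G(s)\big)\le\epsilon$ for all $t\ge T$ and all $t_0\ge0$ (for some norm). *)

theory Defs
  imports "HOL-Analysis.Analysis" "Graph_Theory.Arc_Walk"
begin

definition stochastic :: "real ^ 'm ^ 'm \<Rightarrow> bool" where
  "stochastic A \<longleftrightarrow> (\<forall>i j. 0 \<le> A $ i $ j) \<and> (\<forall>i. (\<Sum>j\<in>UNIV. A $ i $ j) = 1)"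

definition is_norm :: "('v::real_vector \<Rightarrow> real) \<Rightarrow> bool" where
  "is_norm N \<longleftrightarrow>
     (\<forall>x. 0 \<le> N x) \<and> (\<forall>x. N x = 0 \<longleftrightarrow> x = 0) \<and>
     (\<forall>c x. N (c *\<^sub>R x) = \<bar>c\<bar> * N x) \<and> (\<forall>x y. N (x + y) \<le> N x + N y)"

definition hajnal_diam :: "(real ^ 'n \<Rightarrow> real) \<Rightarrow> real ^ 'n ^ 'm \<Rightarrow> real" where
  "hajnal_diam N L = Max {N (row i L - row j L) | i j. True}"

text \<open>\<open>left_prod A a t\<close> is the product of the \<open>t\<close> matrices
  \<open>A (a + t - 1) ** \<dots> ** A a\<close>; the second index is a length, so that no truncated
  subtraction occurs.\<close>

primrec left_prod :: "(nat \<Rightarrow> real ^ 'm ^ 'm) \<Rightarrow> nat \<Rightarrow> nat \<Rightarrow> real ^ 'm ^ 'm" where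
  "left_prod A a 0 = mat 1"
| "left_prod A a (Suc t) = A (a + t) ** left_prod A a t"

text \<open>Suprema and upper limits are taken in the extended reals, so that no boundedness side
  condition is hidden. For nonnegative \<open>x\<close> and \<open>t > 0\<close>, \<open>root t x\<close> is \<open>x\<close> to
  the power \<open>1/t\<close>, also for \<open>x = 0\<close>.\<close>

definition seq_diam :: "(real ^ 'm \<Rightarrow> real) \<Rightarrow> (nat \<Rightarrow> real ^ 'm ^ 'm) \<Rightarrow> ereal" where
  "seq_diam N G =
     limsup (\<lambda>t. SUP t0. ereal (root t (hajnal_diam N (left_prod G t0 t))))"

text \<open>An arc is the pair (tail, head); the entry in row \<open>i\<close> and column \<open>j\<close> gives
  the arc from \<open>j\<close> to \<open>i\<close>.\<close>

definition matrix_digraph :: "real ^ 'm ^ 'm \<Rightarrow> ('m, 'm \<times> 'm) pre_digraph" where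
  "matrix_digraph A =
     \<lparr>verts = UNIV, arcs = {(j, i). j \<noteq> i \<and> 0 < A $ i $ j}, tail = fst, head = snd\<rparr>"

definition union_digraph ::
    "(nat \<Rightarrow> real ^ 'm ^ 'm) \<Rightarrow> nat \<Rightarrow> nat \<Rightarrow> ('m, 'm \<times> 'm) pre_digraph" where
  "union_digraph G t1 t2 =
     \<lparr>verts = UNIV, arcs = (\<Union>k\<in>{t1..t2}. arcs (matrix_digraph (G k))),
      tail = fst, head = snd\<rparr>"

text \<open>This is the rooted, directed notion: the tree is directed away from its root.\<close>

definition has_spanning_tree :: "('a, 'b) pre_digraph \<Rightarrow> bool" where
  "has_spanning_tree D \<longleftrightarrow>
     (\<exists>r\<in>verts D. \<forall>j\<in>verts D. j \<noteq> r \<longrightarrow> (\<exists>p. pre_digraph.apath D r p j))"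

definition uniformly_ergodic :: "(nat \<Rightarrow> real ^ 'm ^ 'm) \<Rightarrow> bool" where
  "uniformly_ergodic G \<longleftrightarrow>
     (\<exists>N. is_norm N \<and>
       (\<forall>\<epsilon>>0. \<exists>T>0. \<forall>t\<ge>T. \<forall>t0. hajnal_diam N (left_prod G t0 t) \<le> \<epsilon>))"

end

theory Submission
  imports Defs
begin

text \<open>Since positive entries are at least \<open>r\<close> and diagonals are positive, the support of a column
  of the running product never shrinks, and over a window whose union graph is rooted at \<open>j\<close> the
  support of column \<open>j\<close> grows strictly until it is full. The total size of the \<open>m\<close> supports is at most
  \<open>m\<^sup>2\<close>, so after \<open>m\<^sup>2 + 1\<close> windows some column is positive, and hence bounded below by a uniform
  \<open>\<delta>\<close>. Such a product contracts the diameter by the factor \<open>1 - \<delta>\<close>, which gives a uniform geometric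
  decay and with it the other two properties. Conversely, either of these makes the rows of a long
  product closer to each other than \<open>1/m\<close>; a column in which some row has an entry
  \<open>\<ge> 1/m\<close> is then positive, and its index is a root of the union graph.\<close>

section \<open>Abstract norms and convex weights\<close>

lemma is_norm_nonneg: "is_norm N \<Longrightarrow> 0 \<le> N x"
  and is_norm_zero: "is_norm N \<Longrightarrow> N x = 0 \<longleftrightarrow> x = 0"
  and is_norm_scaleR: "is_norm N \<Longrightarrow> N (c *\<^sub>R x) = \<bar>c\<bar> * N x"
  and is_norm_triangle: "is_norm N \<Longrightarrow> N (x + y) \<le> N x + N y"
  unfolding is_norm_def by blast+

lemma is_norm_sum_le:
  assumes "is_norm N"
  shows "N (\<Sum>x\<in>A. f x) \<le> (\<Sum>x\<in>A. N (f x))"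
proof (induction A rule: infinite_finite_induct)
  case (insert x A)
  then show ?case using is_norm_triangle[OF assms, of "f x" "sum f A"] by simp
qed (simp_all add: is_norm_zero[OF assms, THEN iffD2])

text \<open>A norm is convex, hence continuous in finite dimension, and so attains a positive
  minimum on the Euclidean unit sphere; homogeneity carries this bound to all vectors. It turns
  smallness in the unspecified norm of \<open>uniformly_ergodic\<close> into smallness of
  entries.\<close>

lemma is_norm_dominates_norm:
  fixes N :: "'a::euclidean_space \<Rightarrow> real"
  assumes "is_norm N"
  obtains b where "b > 0" "\<And>x. b * norm x \<le> N x"
proof -
  have "convex_on UNIV N"
  proof (rule convex_onI)
    fix t :: real and x y :: 'a
    assume "0 < t" "t < 1"
    then show "N ((1 - t) *\<^sub>R x + t *\<^sub>R y) \<le> (1 - t) * N x + t * N y"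
      using is_norm_triangle[OF assms, of "(1 - t) *\<^sub>R x" "t *\<^sub>R y"]
      by (simp add: is_norm_scaleR[OF assms])
  qed simp
  then have "continuous_on (sphere 0 1) N"
    using convex_on_continuous[of UNIV N] continuous_on_subset by blast
  moreover have "sphere (0::'a) 1 \<noteq> {}" by simp
  ultimately have "\<exists>u\<in>sphere 0 1. \<forall>x\<in>sphere 0 1. N u \<le> N x"
    by (intro continuous_attains_inf compact_sphere)
  then obtain u where u: "u \<in> sphere 0 1" "\<forall>x\<in>sphere 0 1. N u \<le> N x" ..
  show thesis
  proof
    show "N u > 0"
      using u(1) is_norm_nonneg[OF assms, of u] is_norm_zero[OF assms, of u]
      by (auto simp: less_le)
    show "N u * norm x \<le> N x" for x
    proof (cases "x = 0")
      case False
      have "N u \<le> N ((1 / norm x) *\<^sub>R x)"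
        using u(2) False by simp
      also have "\<dots> = N x / norm x"
        by (simp add: is_norm_scaleR[OF assms])
      finally show ?thesis using False by (simp add: field_simps)
    qed (simp add: is_norm_nonneg[OF assms])
  qed
qed

text \<open>Both weightings have the same mass \<open>s\<close>, so the product weights
  \<open>a l * b h\<close> couple them: \<open>s\<close> times the difference of the two
  combinations is the sum of all \<open>q l - q h\<close> with these weights, whose total is
  \<open>s * s\<close>.\<close>

lemma is_norm_weighted_diff_le:
  fixes q :: "'k \<Rightarrow> 'v::real_vector"
  assumes "is_norm N" "s > 0"
    and a: "\<And>l. l \<in> I \<Longrightarrow> 0 \<le> a l" "(\<Sum>l\<in>I. a l) = s"
    and b: "\<And>l. l \<in> I \<Longrightarrow> 0 \<le> b l" "(\<Sum>l\<in>I. b l) = s"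
    and D: "\<And>l h. l \<in> I \<Longrightarrow> h \<in> I \<Longrightarrow> N (q l - q h) \<le> D"
  shows "N ((\<Sum>l\<in>I. a l *\<^sub>R q l) - (\<Sum>l\<in>I. b l *\<^sub>R q l)) \<le> s * D"
proof -
  let ?x = "(\<Sum>l\<in>I. a l *\<^sub>R q l) - (\<Sum>l\<in>I. b l *\<^sub>R q l)"
  have "(\<Sum>l\<in>I. \<Sum>h\<in>I. (a l * b h) *\<^sub>R (q l - q h))
      = (\<Sum>l\<in>I. \<Sum>h\<in>I. b h *\<^sub>R a l *\<^sub>R q l) - (\<Sum>l\<in>I. \<Sum>h\<in>I. a l *\<^sub>R b h *\<^sub>R q h)"
    by (simp add: scaleR_diff_right sum_subtractf mult.commute)
  also have "(\<Sum>l\<in>I. \<Sum>h\<in>I. b h *\<^sub>R a l *\<^sub>R q l) = s *\<^sub>R (\<Sum>l\<in>I. a l *\<^sub>R q l)"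
    by (simp only: scaleR_sum_left[symmetric] scaleR_sum_right[symmetric] b(2))
  also have "(\<Sum>l\<in>I. \<Sum>h\<in>I. a l *\<^sub>R b h *\<^sub>R q h) = s *\<^sub>R (\<Sum>l\<in>I. b l *\<^sub>R q l)"
    by (simp only: scaleR_sum_left[symmetric] scaleR_sum_right[symmetric] a(2))
  finally have eq: "s *\<^sub>R ?x = (\<Sum>l\<in>I. \<Sum>h\<in>I. (a l * b h) *\<^sub>R (q l - q h))"
    by (simp add: scaleR_diff_right)
  have "s * N ?x = N (s *\<^sub>R ?x)"
    using \<open>s > 0\<close> by (simp add: is_norm_scaleR[OF assms(1)])
  also have "\<dots> \<le> (\<Sum>l\<in>I. \<Sum>h\<in>I. N ((a l * b h) *\<^sub>R (q l - q h)))"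
    unfolding eq
    by (rule order_trans[OF is_norm_sum_le[OF assms(1)]] sum_mono is_norm_sum_le[OF assms(1)])+
  also have "\<dots> \<le> (\<Sum>l\<in>I. \<Sum>h\<in>I. (a l * b h) * D)"
    by (intro sum_mono) (simp add: is_norm_scaleR[OF assms(1)] a b D mult_left_mono)
  also have "\<dots> = s * (s * D)"
    by (simp only: sum_distrib_right[symmetric] sum_distrib_left[symmetric] a(2) b(2) mult.assoc)
  finally show ?thesis using \<open>s > 0\<close> by simp
qed

section \<open>The Hajnal diameter and contraction by stochastic matrices\<close>

lemma hajnal_diam_eq_Max_image:
  "hajnal_diam N L = Max ((\<lambda>(i, j). N (row i L - row j L)) ` UNIV)"
  unfolding hajnal_diam_def by (rule arg_cong[where f = Max]) auto

lemma row_diff_le_hajnal_diam: "N (row i L - row j L) \<le> hajnal_diam N L"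
  unfolding hajnal_diam_eq_Max_image by (rule Max_ge) (auto intro: image_eqI[of _ _ "(i, j)"])

lemma hajnal_diam_leI:
  "(\<And>i j. N (row i L - row j L) \<le> c) \<Longrightarrow> hajnal_diam N L \<le> c"
  unfolding hajnal_diam_eq_Max_image by (subst Max_le_iff) auto

lemma hajnal_diam_nonneg: "is_norm N \<Longrightarrow> 0 \<le> hajnal_diam N L"
  using is_norm_nonneg[of N] row_diff_le_hajnal_diam[of N undefined L undefined]
  by (meson order_trans)

lemma row_matrix_mult:
  fixes A :: "real ^ 'n ^ 'm" and B :: "real ^ 'k ^ 'n"
  shows "row i (A ** B) = (\<Sum>l\<in>UNIV. A $ i $ l *\<^sub>R row l B)"
  by (simp add: vec_eq_iff matrix_matrix_mult_def row_def)

lemma stochastic_mat_1: "stochastic (mat 1)"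
  by (auto simp: stochastic_def mat_def)

lemma stochastic_mult:
  assumes "stochastic A" "stochastic B"
  shows "stochastic (A ** B)"
  unfolding stochastic_def
proof (intro conjI allI)
  fix i
  have "(\<Sum>j\<in>UNIV. (A ** B) $ i $ j) = (\<Sum>l\<in>UNIV. \<Sum>j\<in>UNIV. A $ i $ l * B $ l $ j)"
    unfolding matrix_matrix_mult_def by simp (rule sum.swap)
  also have "\<dots> = 1"
    using assms by (simp add: sum_distrib_left[symmetric] stochastic_def)
  finally show "(\<Sum>j\<in>UNIV. (A ** B) $ i $ j) = 1" .
qed (use assms in \<open>auto simp: matrix_matrix_mult_def stochastic_def intro!: sum_nonneg\<close>)

text \<open>Every row of \<open>P\<close> gives weight at least \<delta> to row \<open>j\<close> of
  \<open>Q\<close>. This common part cancels in differences of rows, and the remaining weights are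
  nonnegative with total 1 - \<delta>. The case \<delta> = 0 says that stochastic factors on the
  left never enlarge the diameter.\<close>

lemma hajnal_diam_mult_le:
  assumes N: "is_norm N" and P: "stochastic P"
    and \<delta>: "0 \<le> \<delta>" "\<delta> < 1" "\<And>i. \<delta> \<le> P $ i $ j"
  shows "hajnal_diam N (P ** Q) \<le> (1 - \<delta>) * hajnal_diam N Q"
proof (rule hajnal_diam_leI)
  fix i k
  define p where "p i l = P $ i $ l - (if l = j then \<delta> else 0)" for i l
  have split: "row i (P ** Q) = (\<Sum>l\<in>UNIV. p i l *\<^sub>R row l Q) + \<delta> *\<^sub>R row j Q" for i
    by (simp add: row_matrix_mult p_def scaleR_diff_left sum_subtractf if_distrib
        [where f = "\<lambda>c. c *\<^sub>R _"] cong: if_cong)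
  have "N ((\<Sum>l\<in>UNIV. p i l *\<^sub>R row l Q) - (\<Sum>l\<in>UNIV. p k l *\<^sub>R row l Q))
      \<le> (1 - \<delta>) * hajnal_diam N Q"
    using P \<delta> by (intro is_norm_weighted_diff_le[OF N] row_diff_le_hajnal_diam)
      (auto simp: p_def stochastic_def sum_subtractf)
  then show "N (row i (P ** Q) - row k (P ** Q)) \<le> (1 - \<delta>) * hajnal_diam N Q"
    by (simp add: split)
qed

section \<open>Splitting products, and reachability in union graphs\<close>

lemma left_prod_add:
  "left_prod G a (s + t) = left_prod G (a + s) t ** left_prod G a s"
  by (induction t) (simp_all add: matrix_mul_assoc add.assoc)

text \<open>The arcs of \<open>union_digraph\<close> as a plain relation, so that reachability
  becomes its reflexive transitive closure and admits rule induction.\<close>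

definition union_edges :: "(nat \<Rightarrow> real ^ 'm ^ 'm) \<Rightarrow> nat \<Rightarrow> nat \<Rightarrow> ('m \<times> 'm) set" where
  "union_edges G t1 t2 = {(j, i). \<exists>k\<in>{t1..t2}. j \<noteq> i \<and> 0 < G k $ i $ j}"

lemma rtrancl_on_UNIV: "rtrancl_on UNIV R = R\<^sup>*"
proof -
  have "(u, v) \<in> rtrancl_on UNIV R" if "(u, v) \<in> R\<^sup>*" for u v
    using that by induction (auto intro: rtrancl_on_into_rtrancl_on)
  then show ?thesis
    using rtrancl_on_sub_rtrancl[of UNIV R] by auto
qed

text \<open>In a well-formed digraph, reachability is the same as the existence of a simple path;
  the excluded case \<open>j = r\<close> is supplied by reflexivity.\<close>

lemma has_spanning_tree_union_digraph_iff:
  "has_spanning_tree (union_digraph G t1 t2) \<longleftrightarrow> (\<exists>r. \<forall>j. (r, j) \<in> (union_edges G t1 t2)\<^sup>*)"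
proof -
  let ?D = "union_digraph G t1 t2"
  interpret wf_digraph ?D
    by unfold_locales (auto simp: union_digraph_def)
  have ends: "arcs_ends ?D = union_edges G t1 t2"
    by (auto simp: arcs_ends_conv union_digraph_def matrix_digraph_def union_edges_def)
  have V: "verts ?D = UNIV"
    by (simp add: union_digraph_def)
  have "(u \<rightarrow>\<^sup>*\<^bsub>?D\<^esub> v) \<longleftrightarrow> (u, v) \<in> (union_edges G t1 t2)\<^sup>*" for u v
    by (simp add: reachable_def ends V rtrancl_on_UNIV)
  then have "has_spanning_tree ?D \<longleftrightarrow> (\<exists>r. \<forall>j. j \<noteq> r \<longrightarrow> (r, j) \<in> (union_edges G t1 t2)\<^sup>*)"
    by (simp add: has_spanning_tree_def V reachable_apath[symmetric])
  then show ?thesis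
    by (metis rtrancl.rtrancl_refl)
qed

section \<open>Sequences of stochastic matrices: paths behind positive entries, and
  ergodicity\<close>

locale stochastic_seq =
  fixes G :: "nat \<Rightarrow> real ^ 'm ^ 'm"
  assumes stoch: "stochastic (G t)"
begin

lemma nonneg: "0 \<le> G t $ i $ j"
  using stoch by (simp add: stochastic_def)

lemma stochastic_left_prod: "stochastic (left_prod G a t)"
  by (induction t) (simp_all add: stochastic_mat_1 stochastic_mult stoch)

lemma left_prod_nonneg: "0 \<le> left_prod G a t $ i $ j"
  using stochastic_left_prod by (simp add: stochastic_def)

lemma left_prod_Suc_ge: "G (a + t) $ i $ l * left_prod G a t $ l $ j \<le> left_prod G a (Suc t) $ i $ j"
  unfolding left_prod.simps matrix_matrix_mult_def
  by (simp, rule member_le_sum) (auto simp: nonneg left_prod_nonneg)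

lemma left_prod_Suc_posE:
  assumes "0 < left_prod G a (Suc t) $ i $ j"
  obtains l where "0 < G (a + t) $ i $ l" "0 < left_prod G a t $ l $ j"
proof -
  have "\<exists>l. G (a + t) $ i $ l * left_prod G a t $ l $ j \<noteq> 0"
  proof (rule ccontr)
    assume "\<not> ?thesis"
    then have "left_prod G a (Suc t) $ i $ j = 0"
      by (auto simp: matrix_matrix_mult_def intro!: sum.neutral)
    then show False using assms by simp
  qed
  then show thesis
    using that nonneg left_prod_nonneg by (metis less_le mult_eq_0_iff)
qed

text \<open>A positive entry of the product comes from a chain of positive entries of the factors. A
  diagonal entry in the chain gives no arc, hence the reflexive closure in the step. The closed
  window from \<open>a\<close> to \<open>a + T\<close> holds \<open>Suc T\<close> matrices, which
  explains the bound on \<open>t\<close>.\<close>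

lemma left_prod_pos_imp_path:
  "0 < left_prod G a t $ i $ j \<Longrightarrow> t \<le> Suc T \<Longrightarrow> (j, i) \<in> (union_edges G a (a + T))\<^sup>*"
proof (induction t arbitrary: i)
  case 0
  then show ?case by (auto simp: mat_def split: if_splits)
next
  case (Suc t)
  obtain l where l: "0 < G (a + t) $ i $ l" "0 < left_prod G a t $ l $ j"
    using left_prod_Suc_posE[OF Suc.prems(1)] .
  then have "(l, i) \<in> (union_edges G a (a + T))\<^sup>="
    using Suc.prems(2) by (auto simp: union_edges_def)
  then show ?case
    using Suc.IH[OF l(2)] Suc.prems(2) by (auto intro: rtrancl_into_rtrancl)
qed

lemma has_spanning_tree_if_uniformly_ergodic:
  assumes "uniformly_ergodic G"
  shows "\<exists>T>0. \<forall>t0. has_spanning_tree (union_digraph G t0 (t0 + T))"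
proof -
  obtain N where N: "is_norm N"
    and erg: "\<And>\<epsilon>. \<epsilon> > 0 \<Longrightarrow> \<exists>T>0. \<forall>t\<ge>T. \<forall>t0. hajnal_diam N (left_prod G t0 t) \<le> \<epsilon>"
    using assms unfolding uniformly_ergodic_def by blast
  obtain b where b: "b > 0" "\<And>x. b * norm x \<le> N x"
    using is_norm_dominates_norm[OF N] by blast
  define m where "m = real CARD('m)"
  have "m > 0" by (simp add: m_def)
  \<comment> \<open>The factor \<open>b\<close> cancels on passing to the Euclidean norm, so entries
    within a column will differ by at most 1/(2m), which is less than the average entry 1/m of a
    row.\<close>
  obtain T where T: "T > 0" "\<And>t t0. t \<ge> T \<Longrightarrow> hajnal_diam N (left_prod G t0 t) \<le> b / (2 * m)"
    using erg[of "b / (2 * m)"] \<open>b > 0\<close> \<open>m > 0\<close> by auto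
  have "\<exists>j. \<forall>i. (j, i) \<in> (union_edges G a (a + T))\<^sup>*" for a
  proof -
    let ?P = "left_prod G a (Suc T)"
    obtain k :: 'm where True by simp
    have "\<exists>j. 1 / m \<le> ?P $ k $ j"
    proof (rule ccontr)
      assume "\<nexists>j. 1 / m \<le> ?P $ k $ j"
      then have "(\<Sum>j\<in>UNIV. ?P $ k $ j) < (\<Sum>j\<in>(UNIV::'m set). 1 / m)"
        by (intro sum_strict_mono) (auto simp: not_le)
      then show False
        using stochastic_left_prod[of a "Suc T"] by (simp add: stochastic_def m_def)
    qed
    then obtain j where j: "1 / m \<le> ?P $ k $ j" ..
    have "0 < ?P $ i $ j" for i
    proof -
      have "b * norm (row k ?P - row i ?P) \<le> b / (2 * m)"
        using b(2)[of "row k ?P - row i ?P"] row_diff_le_hajnal_diam[of N k ?P i] T(2)[of "Suc T" a]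
        by linarith
      then have "norm (row k ?P - row i ?P) \<le> 1 / (2 * m)"
        using \<open>b > 0\<close> \<open>m > 0\<close> by (simp add: field_simps)
      then have "\<bar>?P $ k $ j - ?P $ i $ j\<bar> \<le> 1 / (2 * m)"
        using component_le_norm_cart[of "row k ?P - row i ?P" j] by (simp add: row_def)
      moreover have "1 / (2 * m) < 1 / m"
        using \<open>m > 0\<close> by (simp add: field_simps)
      ultimately show ?thesis using j by linarith
    qed
    then show ?thesis using left_prod_pos_imp_path[of a "Suc T" _ j T] by blast
  qed
  then show ?thesis
    using \<open>T > 0\<close> unfolding has_spanning_tree_union_digraph_iff by blast
qed

lemma uniformly_ergodic_if_seq_diam_less_1:
  assumes N: "is_norm N" and "seq_diam N G < 1"
  shows "uniformly_ergodic G"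
proof -
  \<comment> \<open>Room below 1 turns the upper limit into an eventual bound by \<open>c\<close>,
    uniform in \<open>t0\<close> because of the inner supremum.\<close>
  obtain c where c: "seq_diam N G < ereal c" "c < 1"
    using ereal_dense2[OF assms(2)] by auto
  then have "\<forall>\<^sub>F t in sequentially.
      (SUP t0. ereal (root t (hajnal_diam N (left_prod G t0 t)))) < ereal c"
    unfolding seq_diam_def by (intro Limsup_lessD)
  then have "\<forall>\<^sub>F t in sequentially. \<forall>t0. root t (hajnal_diam N (left_prod G t0 t)) < c"
    by eventually_elim (auto dest!: SUP_lessD)
  \<comment> \<open>Positivity of \<open>c\<close> is carried along, being read off from a
    nonnegative root below \<open>c\<close>. The index 0 is discarded because \<open>root 0\<close>
    is constantly 0.\<close>
  then have ev: "\<forall>\<^sub>F t in sequentially. \<forall>t0. 0 < c \<and> hajnal_diam N (left_prod G t0 t) \<le> c ^ t"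
    using eventually_gt_at_top[of 0]
  proof eventually_elim
    case (elim t)
    show ?case
    proof
      fix t0
      let ?d = "hajnal_diam N (left_prod G t0 t)"
      have root: "0 \<le> root t ?d" "root t ?d < c"
        using elim hajnal_diam_nonneg[OF N] by (auto intro: real_root_ge_zero)
      have "root t ?d ^ t \<le> c ^ t"
        using root by (intro power_mono) auto
      moreover have "root t ?d ^ t = ?d"
        using elim by (intro real_root_pow_pos2 hajnal_diam_nonneg[OF N]) simp
      ultimately show "0 < c \<and> ?d \<le> c ^ t"
        using root by linarith
    qed
  qed
  then have "0 < c"
    by (auto dest: eventually_happens)
  show ?thesis
    unfolding uniformly_ergodic_def
  proof (intro exI[of _ N] conjI N allI impI)
    fix \<epsilon> :: real
    assume "\<epsilon> > 0"
    then have "\<forall>\<^sub>F t in sequentially. c ^ t < \<epsilon>"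
      using LIMSEQ_power_zero[of c] \<open>0 < c\<close> \<open>c < 1\<close> by (intro order_tendstoD(2)[of _ 0]) auto
    with ev have "\<forall>\<^sub>F t in sequentially. \<forall>t0. hajnal_diam N (left_prod G t0 t) \<le> \<epsilon>"
      by eventually_elim (meson less_imp_le order_trans)
    then obtain T where "\<forall>t\<ge>T. \<forall>t0. hajnal_diam N (left_prod G t0 t) \<le> \<epsilon>"
      unfolding eventually_sequentially by blast
    then show "\<exists>T>0. \<forall>t\<ge>T. \<forall>t0. hajnal_diam N (left_prod G t0 t) \<le> \<epsilon>"
      by (intro exI[of _ "Suc T"]) auto
  qed
qed

end

section \<open>Entries bounded below: growth of column supports and geometric decay\<close>

locale bounded_stochastic_seq = stochastic_seq G for G :: "nat \<Rightarrow> real ^ 'm ^ 'm" +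
  fixes r :: real
  assumes r_pos: "0 < r"
    and entry_ge: "0 < G t $ i $ j \<Longrightarrow> r \<le> G t $ i $ j"
    and diag_gt: "r < G t $ i $ i"
begin

lemma r_less_1: "r < 1"
proof -
  obtain i :: 'm where True by simp
  have "G 0 $ i $ i \<le> (\<Sum>j\<in>UNIV. G 0 $ i $ j)"
    by (rule member_le_sum) (auto simp: nonneg)
  then show ?thesis
    using diag_gt[of 0 i] stoch[of 0] by (simp add: stochastic_def)
qed

text \<open>One positive chain of \<open>t\<close> factors, each at least \<open>r\<close>, already
  contributes this much, and all other terms are nonnegative.\<close>

lemma left_prod_ge_power: "0 < left_prod G a t $ i $ j \<Longrightarrow> r ^ t \<le> left_prod G a t $ i $ j"
proof (induction t arbitrary: i)
  case 0
  then show ?case by (auto simp: mat_def split: if_splits)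
next
  case (Suc t)
  obtain l where l: "0 < G (a + t) $ i $ l" "0 < left_prod G a t $ l $ j"
    using left_prod_Suc_posE[OF Suc.prems] .
  have "r ^ Suc t \<le> G (a + t) $ i $ l * left_prod G a t $ l $ j"
    using entry_ge[OF l(1)] Suc.IH[OF l(2)] r_pos l by (simp add: mult_mono)
  also note left_prod_Suc_ge
  finally show ?case .
qed

text \<open>In graph terms, the vertices reached from \<open>j\<close> after \<open>t\<close> time
  steps starting at time \<open>a\<close>, when staying put is allowed.\<close>

definition supp :: "nat \<Rightarrow> 'm \<Rightarrow> nat \<Rightarrow> 'm set" where
  "supp a j t = {i. 0 < left_prod G a t $ i $ j}"

lemma supp_step:
  assumes "l \<in> supp a j t" "0 < G (a + t) $ i $ l"
  shows "i \<in> supp a j (Suc t)"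
  unfolding supp_def
proof
  have "0 < G (a + t) $ i $ l * left_prod G a t $ l $ j"
    using assms by (simp add: supp_def)
  also note left_prod_Suc_ge
  finally show "0 < left_prod G a (Suc t) $ i $ j" .
qed

lemma supp_mono: "s \<le> t \<Longrightarrow> supp a j s \<subseteq> supp a j t"
proof (rule lift_Suc_mono_le[of "supp a j"])
  show "supp a j n \<subseteq> supp a j (Suc n)" for n
    using supp_step diag_gt r_pos by (meson less_trans subsetI)
qed

lemma self_in_supp: "j \<in> supp a j t"
  using supp_mono[of 0 t a j] by (auto simp: supp_def mat_def)

text \<open>A path from \<open>j\<close> to a vertex outside the support must leave it along some
  arc, present at some time \<open>n\<close> of the window. By monotonicity the tail of that arc is
  still in the support at time \<open>n\<close>, so its head has joined one step later, at the
  latest when the window ends.\<close>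

lemma supp_grows:
  assumes root: "\<And>i. (j, i) \<in> (union_edges G (a + t) (a + t + T))\<^sup>*"
    and "supp a j t \<noteq> UNIV"
  shows "supp a j t \<subset> supp a j (t + Suc T)"
proof -
  let ?E = "union_edges G (a + t) (a + t + T)"
  obtain k where k: "k \<notin> supp a j t" using assms(2) by blast
  have "\<exists>u v. (u, v) \<in> ?E \<and> u \<in> supp a j t \<and> v \<notin> supp a j t"
  proof (rule ccontr)
    assume no_exit: "\<not> ?thesis"
    have "i \<in> supp a j t" if "(j, i) \<in> ?E\<^sup>*" for i
      using that by induction (use no_exit self_in_supp in auto)
    then show False using root k by blast
  qed
  then obtain u v n where uv: "u \<in> supp a j t" "v \<notin> supp a j t"
    and n: "a + t \<le> n" "n \<le> a + t + T" "0 < G n $ v $ u"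
    by (auto simp: union_edges_def)
  define s where "s = n - a"
  have s: "n = a + s" "t \<le> s" "Suc s \<le> t + Suc T"
    using n by (auto simp: s_def)
  have "v \<in> supp a j (Suc s)"
    using supp_step n(3) uv(1) supp_mono[OF s(2)] s(1) by blast
  then show ?thesis
    using uv(2) supp_mono[OF s(3), of a j] supp_mono[of t "t + Suc T" a j] by auto
qed

text \<open>The root may change from window to window, so no single column can be followed. The sum
  of all support sizes serves as potential: it gains at least one per window until some column is
  full, and a full column stays full.\<close>

lemma positive_column:
  assumes tree: "\<And>t0. has_spanning_tree (union_digraph G t0 (t0 + T))"
  shows "\<exists>j. \<forall>i. 0 < left_prod G a (Suc (CARD('m) * CARD('m)) * Suc T) $ i $ j"
proof -
  let ?\<Phi> = "\<lambda>t. \<Sum>j\<in>UNIV. card (supp a j t)"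
  have progress: "(\<exists>j. supp a j (n * Suc T) = UNIV) \<or> n \<le> ?\<Phi> (n * Suc T)" for n
  proof (induction n)
    case (Suc n)
    let ?t = "n * Suc T"
    have t: "Suc n * Suc T = ?t + Suc T" by simp
    have mono: "supp a j ?t \<subseteq> supp a j (?t + Suc T)" for j
      by (rule supp_mono) simp
    show ?case
    proof (cases "\<exists>j. supp a j ?t = UNIV")
      case True
      then show ?thesis unfolding t using mono by (metis top.extremum_unique)
    next
      case False
      obtain j where "\<And>i. (j, i) \<in> (union_edges G (a + ?t) (a + ?t + T))\<^sup>*"
        using tree[of "a + ?t"] unfolding has_spanning_tree_union_digraph_iff by blast
      then have "supp a j ?t \<subset> supp a j (?t + Suc T)"
        using supp_grows False by blast
      then have "?\<Phi> ?t < ?\<Phi> (?t + Suc T)"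
        using mono by (intro sum_strict_mono_ex1) (auto intro!: card_mono psubset_card_mono)
      then show ?thesis
        using Suc False unfolding t by (meson Suc_leI le_less_trans)
    qed
  qed simp
  have "?\<Phi> t \<le> CARD('m) * CARD('m)" for t
  proof -
    have "?\<Phi> t \<le> (\<Sum>j\<in>(UNIV::'m set). CARD('m))"
      by (intro sum_mono card_mono) auto
    then show ?thesis by simp
  qed
  then have "\<not> Suc (CARD('m) * CARD('m)) \<le> ?\<Phi> (Suc (CARD('m) * CARD('m)) * Suc T)"
    using not_less_eq_eq by blast
  then show ?thesis
    using progress[of "Suc (CARD('m) * CARD('m))"] unfolding supp_def by blast
qed

lemma geometric_decay:
  assumes N: "is_norm N"
    and tree: "\<And>t0. has_spanning_tree (union_digraph G t0 (t0 + T))"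
  obtains C \<beta> where "0 < C" "0 < \<beta>" "\<beta> < 1"
    "\<And>t t0. hajnal_diam N (left_prod G t0 t) \<le> C * \<beta> ^ t"
proof -
  define K where "K = Suc (CARD('m) * CARD('m)) * Suc T"
  have "K > 0" by (simp add: K_def)
  define q where "q = 1 - r ^ K"
  have "0 < r ^ K" "r ^ K < 1"
    using r_pos r_less_1 \<open>K > 0\<close> by (auto simp: power_less_one_iff)
  then have q: "0 < q" "q < 1" by (auto simp: q_def)
  \<comment> \<open>The added 1 keeps \<open>C\<close> positive even for a single vertex, where the
    identity has diameter 0.\<close>
  define C where "C = hajnal_diam N (mat 1 :: real ^ 'm ^ 'm) + 1"
  have "C > 0"
    unfolding C_def by (intro add_nonneg_pos hajnal_diam_nonneg[OF N]) simp
  have window: "hajnal_diam N (left_prod G t0 (n * K)) \<le> C * q ^ n" for t0 n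
  proof (induction n)
    case (Suc n)
    obtain j where j: "\<And>i. 0 < left_prod G (t0 + n * K) K $ i $ j"
      using positive_column[OF tree] unfolding K_def by blast
    have "hajnal_diam N (left_prod G t0 (n * K + K)) \<le> q * hajnal_diam N (left_prod G t0 (n * K))"
      unfolding left_prod_add q_def
      using \<open>0 < r ^ K\<close> \<open>r ^ K < 1\<close>
      by (intro hajnal_diam_mult_le[OF N stochastic_left_prod, where j = j] left_prod_ge_power j) auto
    also have "\<dots> \<le> q * (C * q ^ n)"
      using Suc q by (intro mult_left_mono) auto
    finally show ?case by (simp add: ac_simps)
  qed (simp add: C_def)
  define \<beta> where "\<beta> = root K q"
  have \<beta>: "0 < \<beta>" "\<beta> < 1" "\<beta> ^ K = q"
    using q \<open>K > 0\<close> by (simp_all add: \<beta>_def real_root_pow_pos2)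
  show thesis
  proof
    \<comment> \<open>Dividing by \<open>q\<close>, which is \<open>\<beta> ^ K\<close>, pays for
      rounding \<open>t\<close> up to the next multiple of \<open>K\<close>.\<close>
    show "0 < C / q" using \<open>C > 0\<close> q by simp
    show "hajnal_diam N (left_prod G t0 t) \<le> C / q * \<beta> ^ t" for t t0
    proof -
      define n where "n = t div K"
      define s where "s = t mod K"
      have t: "t = n * K + s" by (simp add: n_def s_def)
      have "s < K" using \<open>K > 0\<close> by (simp add: s_def)
      \<comment> \<open>The last \<open>s\<close> factors form an incomplete block, for which the
        contraction estimate is used with \<delta> = 0.\<close>
      have "hajnal_diam N (left_prod G t0 t) \<le> (1 - 0) * hajnal_diam N (left_prod G t0 (n * K))"
        unfolding t left_prod_add
        by (intro hajnal_diam_mult_le[OF N stochastic_left_prod] left_prod_nonneg) auto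
      also have "\<dots> \<le> C * q ^ n"
        using window by simp
      also have "\<dots> = C / q * \<beta> ^ (K * Suc n)"
        unfolding power_mult \<beta>(3) using q by simp
      also have "\<dots> \<le> C / q * \<beta> ^ t"
      proof (intro mult_left_mono power_decreasing)
        show "t \<le> K * Suc n"
          using \<open>s < K\<close> by (simp add: t mult.commute)
      qed (use \<beta> \<open>C > 0\<close> q in auto)
      finally show ?thesis .
    qed
  qed (fact \<beta>)+
qed

lemma seq_diam_less_1_if_spanning_tree:
  assumes N: "is_norm N"
    and tree: "\<And>t0. has_spanning_tree (union_digraph G t0 (t0 + T))"
  shows "seq_diam N G < 1"
proof -
  obtain C \<beta> where C: "0 < C" and \<beta>: "0 < \<beta>" "\<beta> < 1"
    and decay: "\<And>t t0. hajnal_diam N (left_prod G t0 t) \<le> C * \<beta> ^ t"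
    using geometric_decay[OF N tree] by blast
  \<comment> \<open>The roots of the decay bound are \<open>root t C * \<beta>\<close>, which tend
    to \<beta> but may exceed it; an intermediate \<open>c\<close> absorbs the excess
    eventually.\<close>
  obtain c where c: "\<beta> < c" "c < 1"
    using dense[OF \<beta>(2)] by blast
  have "(\<lambda>t. root t C * \<beta>) \<longlonglongrightarrow> 1 * \<beta>"
    by (intro tendsto_intros LIMSEQ_root_const C)
  then have "\<forall>\<^sub>F t in sequentially. root t C * \<beta> < c"
    using c by (intro order_tendstoD(2)) auto
  then have "\<forall>\<^sub>F t in sequentially.
      (SUP t0. ereal (root t (hajnal_diam N (left_prod G t0 t)))) \<le> ereal c"
    using eventually_gt_at_top[of 0]
  proof eventually_elim
    case (elim t)
    have "root t (hajnal_diam N (left_prod G t0 t)) \<le> root t (C * \<beta> ^ t)" for t0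
      using elim decay by simp
    moreover have "root t (C * \<beta> ^ t) = root t C * \<beta>"
      using elim \<beta> by (simp add: real_root_mult real_root_power_cancel)
    ultimately show ?case
      using elim by (intro SUP_least) (smt (verit) ereal_less_eq(3))
  qed
  then have "seq_diam N G \<le> ereal c"
    unfolding seq_diam_def by (rule Limsup_bounded)
  also have "\<dots> < 1" using c by simp
  finally show ?thesis .
qed

end

theorem theorem3:
  fixes M :: "(real ^ 'm ^ 'm) set"
    and G :: "nat \<Rightarrow> real ^ 'm ^ 'm"
    and N :: "real ^ 'm \<Rightarrow> real"
  assumes "\<forall>A\<in>M. stochastic A"
    and "compact M"
    and "\<exists>r>0. \<forall>A\<in>M. (\<forall>i j. 0 < A $ i $ j \<longrightarrow> r \<le> A $ i $ j) \<and> (\<forall>i. r < A $ i $ i)"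
    and "\<forall>t. G t \<in> M"
    and "is_norm N"
  shows "(seq_diam N G < 1 \<longleftrightarrow> (\<exists>T>0. \<forall>t0. has_spanning_tree (union_digraph G t0 (t0 + T))))
    \<and> ((\<exists>T>0. \<forall>t0. has_spanning_tree (union_digraph G t0 (t0 + T))) \<longleftrightarrow> uniformly_ergodic G)"
proof -
  obtain r where r: "r > 0"
    "\<And>A. A \<in> M \<Longrightarrow> (\<forall>i j. 0 < A $ i $ j \<longrightarrow> r \<le> A $ i $ j) \<and> (\<forall>i. r < A $ i $ i)"
    using assms(3) by blast
  interpret bounded_stochastic_seq G r
    using assms(1,4) r by unfold_locales blast+
  show ?thesis
    \<comment> \<open>The implications close a cycle: spanning trees give diameter below 1, this
      gives ergodicity, and ergodicity gives spanning trees.\<close>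
    using seq_diam_less_1_if_spanning_tree[OF assms(5)]
      uniformly_ergodic_if_seq_diam_less_1[OF assms(5)]
      has_spanning_tree_if_uniformly_ergodic
    by blast
qed

end
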